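(* Let $\mu$ be an infinite cardinal and let $G$ be a graph with $\operatorname{col}(G)>\mu$. Then $G$ contains either a $K_\mu$ or, for each positive integer $k$, an induced $K_{k,\omega}$.
   Context: Graphs are simple and undirected, possibly infinite; $N(v)$ denotes the set of neighbours of a vertex $v$. The colouring number $\operatorname{col}(G)$ of a graph $G=(V,E)$ is the smallest cardinal $\kappa$ such that there exists a well-ordering $<^*$ of $V$ with $|N(v)\cap\{w : w<^* v\}|<\kappa$ for all $v\in V$. Here $K_\mu$ denotes the complete graph on $\mu$ vertices, i.e. containing a $K_\mu$ means containing $\mu$ mutually adjacent vertices, and $K_{k,\omega}$ denotes the complete bipartite graph whose classes have sizes $k$ and $\omega$ (countably infinite). *)

theory Defs
  imports Main
begin

unbundle cardinal_syntax

text \<open>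
  A graph is given by its vertex set and its set of edges, an edge being the two-element set of
  its ends. Cardinals are cardinal well-orders (\<open>Card_order\<close>), compared up to isomorphism by the
  heterogeneous relations \<open>\<le>o\<close>, \<open><o\<close> and \<open>=o\<close>.
\<close>

definition simple_graph :: "'a set \<Rightarrow> 'a set set \<Rightarrow> bool" where
  "simple_graph V E \<longleftrightarrow> (\<forall>e\<in>E. e \<subseteq> V \<and> card e = 2)"

definition neighbours :: "'a set set \<Rightarrow> 'a \<Rightarrow> 'a set" where
  "neighbours E v = {w. {v, w} \<in> E}"

definition has_colouring_order :: "'a set \<Rightarrow> 'a set set \<Rightarrow> 'b rel \<Rightarrow> bool" where
  "has_colouring_order V E \<kappa> \<longleftrightarrow>
    (\<exists>r. well_order_on V r \<and> (\<forall>v\<in>V. |neighbours E v \<inter> underS r v| <o \<kappa>))"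

text \<open>
  The minimum is taken over cardinals carried by subsets of the vertex type. This loses nothing:
  since \<open>|V|\<close> itself qualifies, the result is least among qualifying cardinals on
  any type, see \<open>colouring_number_least\<close>.
\<close>

definition colouring_number :: "'a set \<Rightarrow> 'a set set \<Rightarrow> 'a rel" where
  "colouring_number V E =
    (SOME \<kappa>. Card_order \<kappa> \<and> has_colouring_order V E \<kappa> \<and>
      (\<forall>\<kappa>' :: 'a rel. Card_order \<kappa>' \<and> has_colouring_order V E \<kappa>' \<longrightarrow> \<kappa> \<le>o \<kappa>'))"

definition complete_edges :: "'a set \<Rightarrow> 'a set set" where
  "complete_edges S = {{x, y} |x y. x \<in> S \<and> y \<in> S \<and> x \<noteq> y}"

definition bipartite_edges :: "'a set \<Rightarrow> 'a set \<Rightarrow> 'a set set" where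
  "bipartite_edges A B = {{a, b} |a b. a \<in> A \<and> b \<in> B}"

definition induced_edges :: "'a set set \<Rightarrow> 'a set \<Rightarrow> 'a set set" where
  "induced_edges E S = {e \<in> E. e \<subseteq> S}"

definition contains_complete :: "'a set \<Rightarrow> 'a set set \<Rightarrow> 'b rel \<Rightarrow> bool" where
  "contains_complete V E \<mu> \<longleftrightarrow> (\<exists>S\<subseteq>V. |S| =o \<mu> \<and> complete_edges S \<subseteq> E)"

definition contains_induced_K_omega :: "'a set \<Rightarrow> 'a set set \<Rightarrow> nat \<Rightarrow> bool" where
  "contains_induced_K_omega V E k \<longleftrightarrow>
    (\<exists>A B. A \<subseteq> V \<and> B \<subseteq> V \<and> A \<inter> B = {} \<and> finite A \<and> card A = k \<and> |B| =o natLeq \<and>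
      induced_edges E (A \<union> B) = bipartite_edges A B)"

lemma has_colouring_order_cong:
  assumes "has_colouring_order V E \<kappa>" "\<kappa> =o \<kappa>'"
  shows "has_colouring_order V E \<kappa>'"
  using assms unfolding has_colouring_order_def by (meson ordLess_ordIso_trans)

lemma has_colouring_order_card_of: "has_colouring_order V E |V|"
proof -
  have card: "card_order_on V |V|"
    by (rule card_of_card_order_on)
  have "|neighbours E v \<inter> underS |V| v| <o |V|" if "v \<in> V" for v
  proof -
    have "|underS |V| v| <o |V|"
      using that card_of_underS[OF card_of_Card_order, of v V] by (simp add: Field_card_of)
    moreover have "|neighbours E v \<inter> underS |V| v| \<le>o |underS |V| v|"
      by (intro card_of_mono1) auto
    ultimately show ?thesis by (rule ordLeq_ordLess_trans[rotated])
  qed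
  then show ?thesis
    using card unfolding has_colouring_order_def card_order_on_def by blast
qed

lemma colouring_number_properties:
  fixes V :: "'a set"
  shows "Card_order (colouring_number V E) \<and> has_colouring_order V E (colouring_number V E) \<and>
    (\<forall>\<kappa>' :: 'a rel. Card_order \<kappa>' \<and> has_colouring_order V E \<kappa>' \<longrightarrow> colouring_number V E \<le>o \<kappa>')"
  unfolding colouring_number_def
proof (rule someI_ex)
  let ?C = "{\<kappa> :: 'a rel. Card_order \<kappa> \<and> has_colouring_order V E \<kappa>}"
  have "|V| \<in> ?C"
    by (simp add: card_of_Card_order has_colouring_order_card_of)
  then have "\<exists>\<kappa>\<in>?C. \<forall>\<kappa>'\<in>?C. \<kappa> \<le>o \<kappa>'"
    by (intro exists_minim_Card_order) auto
  then show "\<exists>\<kappa> :: 'a rel. Card_order \<kappa> \<and> has_colouring_order V E \<kappa> \<and>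
      (\<forall>\<kappa>' :: 'a rel. Card_order \<kappa>' \<and> has_colouring_order V E \<kappa>' \<longrightarrow> \<kappa> \<le>o \<kappa>')"
    by simp
qed

lemma colouring_number_least:
  fixes V :: "'a set" and \<kappa> :: "'b rel"
  assumes \<kappa>: "Card_order \<kappa>" "has_colouring_order V E \<kappa>"
  shows "colouring_number V E \<le>o \<kappa>"
proof (cases "|V| \<le>o \<kappa>")
  case True
  have "colouring_number V E \<le>o |V|"
    using colouring_number_properties[of V E] card_of_Card_order has_colouring_order_card_of
    by blast
  then show ?thesis using True by (rule ordLeq_transitive)
next
  case False
  have "|Field \<kappa>| \<le>o |V|"
    using False \<kappa>(1) by (meson card_of_Field_ordIso card_of_Well_order card_order_on_well_order_on
        not_ordLeq_iff_ordLess ordIso_ordLess_trans ordLess_imp_ordLeq)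
  then obtain B :: "'a set" where "|Field \<kappa>| =o |B|"
    using internalize_card_of_ordLeq2[of "Field \<kappa>" V] by blast
  then have iso: "\<kappa> =o |B|"
    using card_of_Field_ordIso[OF \<kappa>(1)] ordIso_symmetric ordIso_transitive by blast
  then have "colouring_number V E \<le>o |B|"
    using colouring_number_properties[of V E] has_colouring_order_cong[OF \<kappa>(2)]
      card_of_Card_order by blast
  then show ?thesis using ordIso_symmetric[OF iso] by (rule ordLeq_ordIso_trans)
qed

end

theory Submission
  imports Defs "HOL.Hull"
begin

text \<open>
  By the Dushnik--Miller relation \<open>\<mu> \<rightarrow> (\<mu>, \<omega>)\<close>, a set of at least \<open>\<mu>\<close> vertices of a graph without
  \<open>K\<^sub>\<mu>\<close> contains an infinite independent set. So if there is no induced \<open>K\<^bsub>k,\<omega>\<^esub>\<close> either, every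
  independent \<open>k\<close>-set has fewer than \<open>\<mu>\<close> common neighbours. Call \<open>U\<close> closed if it contains the common
  neighbours of its independent \<open>k\<close>-subsets: a vertex \<open>v\<close> outside \<open>U\<close> has fewer than \<open>\<mu>\<close> neighbours in
  \<open>U\<close>, as otherwise \<open>v\<close> is a common neighbour of some independent \<open>k\<close>-subset of \<open>U\<close>. Closing the
  initial segments of a well-order of type \<open>|V|\<close> writes \<open>V\<close> as an increasing union of closed sets of
  size less than \<open>|V|\<close>; by induction on \<open>|V|\<close> the successive differences have suitable orders, and
  these are concatenated.
\<close>

section \<open>The Dushnik--Miller relation\<close>

lemma not_card_of_ordLess: "\<not> |A| <o |B| \<longleftrightarrow> |B| \<le>o |A|"
  by (simp add: not_ordLess_iff_ordLeq card_of_Well_order)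

lemma not_card_of_ordLeq: "\<not> |A| \<le>o |B| \<longleftrightarrow> |B| <o |A|"
  by (simp add: not_ordLeq_iff_ordLess card_of_Well_order)

lemma finite_card_of_ordLess: "finite A \<Longrightarrow> infinite B \<Longrightarrow> |A| <o |B|"
  using finite_ordLess_infinite[OF card_of_Well_order card_of_Well_order] by (simp add: Field_card_of)

text \<open>The uniform bound \<open>B\<close> replaces regularity of \<open>|C|\<close>: an
  infinite \<open>I <+> B\<close> bounds the sum and is still smaller than \<open>C\<close>, and a
  finite one makes the sum finite.\<close>

lemma card_of_Sigma_ordLess_infinite:
  assumes "infinite C" "|I| <o |C|" "|B| <o |C|" "\<And>i. i \<in> I \<Longrightarrow> |A i| \<le>o |B|"
  shows "|SIGMA i:I. A i| <o |C|"
proof (cases "finite (I <+> B)")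
  case True
  then have "finite (SIGMA i:I. A i)"
    using assms(4) card_of_ordLeq_finite by (intro finite_SigmaI) auto
  then show ?thesis
    using assms(1) by (rule finite_card_of_ordLess)
next
  case False
  have "|A i| \<le>o |I <+> B|" if "i \<in> I" for i
    using assms(4)[OF that] card_of_Plus2 by (rule ordLeq_transitive)
  then have "|SIGMA i:I. A i| \<le>o |I <+> B|"
    using False by (intro card_of_Sigma_ordLeq_infinite card_of_Plus1) auto
  then show ?thesis
    using card_of_Plus_ordLess_infinite[OF assms(1-3)] by (rule ordLeq_ordLess_trans)
qed

lemma card_of_UNION_bounded_ordLess_infinite:
  assumes "infinite C" "|I| <o |C|" "|B| <o |C|" "\<And>i. i \<in> I \<Longrightarrow> |A i| \<le>o |B|"
  shows "|\<Union>i\<in>I. A i| <o |C|"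
  using card_of_UNION_Sigma card_of_Sigma_ordLess_infinite[OF assms] by (rule ordLeq_ordLess_trans)

text \<open>
  The vertex \<open>y\<close> counts as its own non-neighbour, so that sets avoiding the non-neighbours of
  each other are disjoint.
\<close>

definition non_neighbours :: "'a set set \<Rightarrow> 'a set \<Rightarrow> 'a \<Rightarrow> 'a set" where
  "non_neighbours E Y y = {z \<in> Y. z = y \<or> {y, z} \<notin> E}"

text \<open>Otherwise every \<open>Y\<close> of full size has a vertex with a full-size set of
  non-neighbours. Passing to that set again and again picks an infinite sequence of pairwise
  non-adjacent vertices.\<close>

lemma ex_core_with_small_non_neighbours:
  fixes X :: "'a set"
  assumes inf: "infinite X"
    and no_indep: "\<And>S. S \<subseteq> X \<Longrightarrow> infinite S \<Longrightarrow> complete_edges S \<inter> E \<noteq> {}"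
  shows "\<exists>Y\<subseteq>X. |Y| =o |X| \<and> (\<forall>y\<in>Y. |non_neighbours E Y y| <o |Y| )"
proof (rule ccontr)
  assume neg: "\<not> ?thesis"
  \<comment> \<open>Unlike \<open>non_neighbours\<close>, this omits \<open>y\<close>, so that the
    vertices picked are distinct; dropping one point leaves an infinite size unchanged.\<close>
  define M where "M Y y = {z \<in> Y. z \<noteq> y \<and> {y, z} \<notin> E}" for Y y
  have step: "\<exists>y\<in>Y. |M Y y| =o |X|" if Y: "Y \<subseteq> X" "|Y| =o |X|" for Y
  proof -
    have infY: "infinite Y"
      using Y(2) inf card_of_ordIso_finite by blast
    obtain y where y: "y \<in> Y" "\<not> |non_neighbours E Y y| <o |Y|"
      using neg Y by blast
    have "non_neighbours E Y y = {y} \<union> M Y y"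
      using y(1) by (auto simp: non_neighbours_def M_def)
    then have "\<not> |M Y y| <o |Y|"
      using y(2) card_of_Un_ordLess_infinite[OF infY finite_card_of_ordLess[OF _ infY, of "{y}"]]
      by auto
    moreover have "|M Y y| \<le>o |Y|"
      by (rule card_of_mono1) (auto simp: M_def)
    ultimately have "|M Y y| =o |Y|"
      by (simp add: ordIso_iff_ordLeq not_card_of_ordLess)
    then show ?thesis
      using y(1) Y(2) ordIso_transitive by blast
  qed
  \<comment> \<open>A pair consists of the current reservoir \<open>Y\<close> and the vertex
    \<open>y\<close> picked from it; the next reservoir is \<open>M Y y\<close>. The index
    \<open>n\<close> only fits the form of dependent choice.\<close>
  define P where "P = (\<lambda>(n::nat) (Y, y). Y \<subseteq> X \<and> |Y| =o |X| \<and> y \<in> Y \<and> |M Y y| =o |X| )"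
  obtain f where f: "\<And>n. P n (f n)" "\<And>n. fst (f (Suc n)) = M (fst (f n)) (snd (f n))"
  proof -
    have "\<exists>f. \<forall>n. P n (f n) \<and> fst (f (Suc n)) = M (fst (f n)) (snd (f n))"
    proof (rule dependent_nat_choice)
      show "\<exists>p. P 0 p"
        using step[OF subset_refl card_of_refl] card_of_refl by (fastforce simp: P_def)
    next
      fix p n assume p: "P n p"
      have "M (fst p) (snd p) \<subseteq> X" "|M (fst p) (snd p)| =o |X|"
        using p by (auto simp: P_def M_def split: prod.splits)
      from this step[OF this] show "\<exists>q. P (Suc n) q \<and> fst q = M (fst p) (snd p)"
        by (auto simp: P_def)
    qed
    then show ?thesis using that by blast
  qed
  define s where "s n = snd (f n)" for n
  have dec: "fst (f n) \<subseteq> fst (f m)" if "m \<le> n" for m n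
    using that by (induction n rule: dec_induct) (auto simp: f(2) M_def)
  have lt: "s n \<noteq> s m \<and> {s m, s n} \<notin> E" if "m < n" for m n
  proof -
    have "s n \<in> fst (f n)"
      using f(1)[of n] by (auto simp: P_def s_def split: prod.splits)
    then have "s n \<in> fst (f (Suc m))"
      using dec[of "Suc m" n] that by auto
    then show ?thesis
      by (simp add: f(2) M_def s_def)
  qed
  have "inj s"
    by (rule linorder_injI) (metis lt)
  then have "infinite (range s)"
    using finite_imageD[of s UNIV] by auto
  moreover have "range s \<subseteq> X"
    using f(1) by (auto simp: P_def s_def split_beta)
  moreover have "complete_edges (range s) \<inter> E = {}"
  proof -
    have "{s m, s n} \<notin> E" if "s m \<noteq> s n" for m n
      using that lt[of m n] lt[of n m] by (metis insert_commute linorder_neqE_nat)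
    then show ?thesis
      by (auto simp: complete_edges_def)
  qed
  ultimately show False
    using no_indep by blast
qed

text \<open>
  The least possible size of the index set \<open>A\<close> is the cofinality of \<open>|Y|\<close>. If it is \<open>|Y|\<close> itself,
  singletons are used: this is how regular cardinals, in particular \<open>\<omega>\<close>, avoid the induction
  hypothesis of \<open>ex_clique_or_independent\<close>.
\<close>

lemma ex_cofinal_family:
  fixes Y :: "'a set"
  assumes inf: "infinite Y"
  obtains A :: "'a set" and F :: "'a \<Rightarrow> 'a set"
  where "\<And>a. a \<in> A \<Longrightarrow> |F a| <o |Y|" "|Y| \<le>o |Sigma A F|"
    "\<And>(B :: 'a set) (G :: 'a \<Rightarrow> 'a set). |B| <o |A| \<Longrightarrow> \<forall>b\<in>B. |G b| <o |Y| \<Longrightarrow> |Sigma B G| <o |Y|"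
    "|A| <o |Y| \<or> (\<forall>a\<in>A. finite (F a) \<and> card (F a) = 1)"
proof -
  \<comment> \<open>The index sets over which sets smaller than \<open>Y\<close> can sum to at least
    \<open>|Y|\<close>. Singletons show that \<open>Y\<close> is one, so there is one of least
    size.\<close>
  define Q where "Q = {A :: 'a set. \<exists>F :: 'a \<Rightarrow> 'a set. (\<forall>a\<in>A. |F a| <o |Y| ) \<and> |Y| \<le>o |Sigma A F|}"
  have sing: "|Y| \<le>o |SIGMA a:Y. {a}|"
    using card_of_image[of fst "SIGMA a:Y. {a}"] by (simp add: fst_image_Sigma)
  have sing_less: "|{a}| <o |Y|" for a :: 'a
    using inf by (intro finite_card_of_ordLess) auto
  have YQ: "Y \<in> Q"
    unfolding Q_def using sing sing_less
    by (intro CollectI exI[of _ "\<lambda>a. {a}"]) simp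
  obtain A where A: "A \<in> Q" "\<And>B. |B| <o |A| \<Longrightarrow> B \<notin> Q"
    using wfE_min[OF wf_inv_image[OF wf_ordLess, of card_of] YQ] by (auto simp: inv_image_def)
  have below: "|Sigma B G| <o |Y|" if "|B| <o |A|" "\<forall>b\<in>B. |G b| <o |Y|"
    for B :: "'a set" and G :: "'a \<Rightarrow> 'a set"
    using A(2)[OF that(1)] that(2) not_card_of_ordLess unfolding Q_def by blast
  show ?thesis
  proof (cases "|A| <o |Y|")
    case True
    then show ?thesis
      using that below A(1) unfolding Q_def by blast
  next
    case False
    then have "|Y| \<le>o |A|" by (simp add: not_card_of_ordLess)
    \<comment> \<open>Here the minimality of \<open>A\<close> makes \<open>|Y|\<close> regular, so
      \<open>Y\<close> with singletons serves in place of \<open>A\<close>.\<close>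
    then have "|Sigma B G| <o |Y|" if "|B| <o |Y|" "\<forall>b\<in>B. |G b| <o |Y|"
      for B :: "'a set" and G :: "'a \<Rightarrow> 'a set"
      using below that ordLess_ordLeq_trans by blast
    then show ?thesis
      using that[of Y "\<lambda>a. {a}"] sing sing_less by simp
  qed
qed

text \<open>Work in a core \<open>Y\<close> whose vertices have few non-neighbours, with a cofinal
  family \<open>F\<close> over \<open>A\<close>. Cliques \<open>f a\<close> of size at least
  \<open>|F a|\<close> are chosen along a well-order of \<open>A\<close>, each avoiding the
  non-neighbours of all earlier ones, and their union is a clique of size
  \<open>|Y|\<close>.\<close>

lemma ex_clique_or_independent:
  fixes X :: "'a set"
  assumes "infinite X"
    and "\<And>S. S \<subseteq> X \<Longrightarrow> infinite S \<Longrightarrow> complete_edges S \<inter> E \<noteq> {}"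
  shows "\<exists>S\<subseteq>X. |S| =o |X| \<and> complete_edges S \<subseteq> E"
  using assms
proof (induction X rule: wf_induct_rule[OF wf_inv_image[OF wf_ordLess, of card_of]])
  case (1 X)
  have IH: "\<exists>S\<subseteq>Z. |S| =o |Z| \<and> complete_edges S \<subseteq> E"
    if "Z \<subseteq> X" "|Z| <o |X|" "infinite Z" for Z
    using "1.IH"[of Z] "1.prems"(2) that by (auto simp: inv_image_def)
  obtain Y where Y: "Y \<subseteq> X" "|Y| =o |X|"
    and small: "\<And>y. y \<in> Y \<Longrightarrow> |non_neighbours E Y y| <o |Y|"
    using ex_core_with_small_non_neighbours[of X E] "1.prems" by blast
  have infY: "infinite Y"
    using Y(2) "1.prems"(1) card_of_ordIso_finite by blast
  obtain A :: "'a set" and F :: "'a \<Rightarrow> 'a set" where AF: "\<And>a. a \<in> A \<Longrightarrow> |F a| <o |Y|" "|Y| \<le>o |Sigma A F|"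
    and below: "\<And>(B :: 'a set) (G :: 'a \<Rightarrow> 'a set). |B| <o |A| \<Longrightarrow> \<forall>b\<in>B. |G b| <o |Y| \<Longrightarrow> |Sigma B G| <o |Y|"
    and cases: "|A| <o |Y| \<or> (\<forall>a\<in>A. finite (F a) \<and> card (F a) = 1)"
    using ex_cofinal_family[OF infY] by blast
  define N where "N K = (\<Union>x\<in>K. non_neighbours E Y x)" for K
  \<comment> \<open>The cliques \<open>K\<close> of size at least \<open>|F a|\<close> are assembled into one of size \<open>|Y|\<close> below. Having few
    non-neighbours in total is what lets the construction continue after \<open>K\<close>; if \<open>|Y|\<close> is singular,
    this requires a uniform bound \<open>|F b|\<close> on the non-neighbours of the elements of \<open>K\<close>.\<close>
  have piece: "\<exists>K\<subseteq>Z. complete_edges K \<subseteq> E \<and> |F a| \<le>o |K| \<and> |N K| <o |Y|"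
    if Z: "Z \<subseteq> Y" "|Y| \<le>o |Z|" and a: "a \<in> A" for Z a
    using cases
  proof
    assume "\<forall>a\<in>A. finite (F a) \<and> card (F a) = 1"
    then have "card (F a) = 1" using a by blast
    then obtain c where c: "F a = {c}" using card_1_singletonE by blast
    obtain z where z: "z \<in> Z"
      using Z(2) infY card_of_ordLeq_infinite by fastforce
    have "|F a| \<le>o |{z}|" unfolding c by (rule card_of_singl_ordLeq) simp
    then show ?thesis
      using z Z(1) small[of z] by (intro exI[of _ "{z}"]) (auto simp: complete_edges_def N_def)
  next
    assume A: "|A| <o |Y|"
    \<comment> \<open>Classes of vertices with a uniform bound on their non-neighbours. They cover
      \<open>Z\<close>: a vertex in no class would have a non-neighbour set, smaller than
      \<open>Y\<close>, that bounds every \<open>|F b|\<close>, forcing \<open>Sigma A F\<close>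
      below \<open>|Y|\<close>.\<close>
    define Z' where "Z' b = {z \<in> Z. |non_neighbours E Y z| \<le>o |F b|}" for b
    have cover: "Z \<subseteq> (\<Union>b\<in>A. Z' b)"
    proof
      fix z assume z: "z \<in> Z"
      have "\<exists>b\<in>A. |non_neighbours E Y z| \<le>o |F b|"
      proof (rule ccontr)
        assume "\<not> ?thesis"
        then have "|F b| \<le>o |non_neighbours E Y z|" if "b \<in> A" for b
          using that by (simp add: not_card_of_ordLeq ordLess_imp_ordLeq)
        then have "|Sigma A F| <o |Y|"
          using card_of_Sigma_ordLess_infinite[OF infY A small[of z], of F] z Z(1) by blast
        then show False
          using AF(2) not_card_of_ordLess by blast
      qed
      then show "z \<in> (\<Union>b\<in>A. Z' b)"
        using z by (auto simp: Z'_def)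
    qed
    \<comment> \<open>The size of the clique to be found. It must be infinite for the induction
      hypothesis to apply; if \<open>F a\<close> is finite, \<open>A\<close> or some other
      \<open>F b\<close> is infinite because the whole sum is.\<close>
    obtain B :: "'a set" where B: "infinite B" "|F a| \<le>o |B|" "|B| <o |Y|"
    proof (cases "finite (F a)")
      case False
      show ?thesis by (rule that[OF False card_of_mono1[OF subset_refl] AF(1)[OF a]])
    next
      case True
      have "infinite A \<or> (\<exists>b\<in>A. infinite (F b))"
      proof (rule ccontr)
        assume "\<not> ?thesis"
        then have "finite (Sigma A F)" by auto
        then show False using card_of_ordLeq_infinite[OF AF(2) infY] by simp
      qed
      then have "\<exists>B :: 'a set. infinite B \<and> |B| <o |Y|"
        using AF(1) A by auto
      then obtain B :: "'a set" where B: "infinite B" "|B| <o |Y|"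
        by (elim exE conjE)
      show ?thesis
        by (rule that[OF B(1) ordLess_imp_ordLeq[OF finite_card_of_ordLess[OF True B(1)]] B(2)])
    qed
    \<comment> \<open>Fewer than \<open>|Y|\<close> classes cover \<open>Z\<close>, so they cannot
      all be bounded by the one size \<open>|B|\<close>.\<close>
    have "\<exists>b\<in>A. |B| \<le>o |Z' b|"
    proof (rule ccontr)
      assume "\<not> ?thesis"
      then have "|Z' b| \<le>o |B|" if "b \<in> A" for b
        using that by (simp add: not_card_of_ordLeq ordLess_imp_ordLeq)
      then have "|\<Union>b\<in>A. Z' b| <o |Y|"
        using card_of_UNION_bounded_ordLess_infinite[OF infY A B(3)] by blast
      then have "|Z| <o |Y|"
        using card_of_mono1[OF cover] ordLeq_ordLess_trans by blast
      then show False
        using Z(2) not_card_of_ordLess by blast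
    qed
    then obtain b where b: "b \<in> A" "|B| \<le>o |Z' b|" by blast
    then obtain B' where B': "B' \<subseteq> Z' b" "|B| =o |B'|"
      using internalize_card_of_ordLeq2[of B "Z' b"] by blast
    have "infinite B'" using B'(2) B(1) card_of_ordIso_finite by blast
    moreover have B'Y: "|B'| <o |Y|" using B'(2) B(3) ordIso_symmetric ordIso_ordLess_trans by blast
    moreover have "B' \<subseteq> X" using B'(1) Z(1) Y(1) by (auto simp: Z'_def)
    \<comment> \<open>The induction hypothesis turns \<open>B'\<close> into a clique of the same
      size; lying inside one class, it has few non-neighbours in total.\<close>
    ultimately obtain K where K: "K \<subseteq> B'" "|K| =o |B'|" "complete_edges K \<subseteq> E"
      using IH[of B'] Y(2) ordLess_ordIso_trans by blast
    have "|K| <o |Y|" using K(2) B'Y ordIso_ordLess_trans by blast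
    moreover have "|non_neighbours E Y x| \<le>o |F b|" if "x \<in> K" for x
      using that K(1) B'(1) by (auto simp: Z'_def)
    ultimately have "|N K| <o |Y|"
      using card_of_UNION_bounded_ordLess_infinite[OF infY _ AF(1)[OF b(1)]] unfolding N_def by blast
    moreover have "|F a| \<le>o |K|"
      using B(2) B'(2) K(2) by (meson ordIso_symmetric ordLeq_ordIso_trans)
    moreover have "K \<subseteq> Z" using K(1) B'(1) by (auto simp: Z'_def)
    ultimately show ?thesis using K(3) by blast
  qed
  define r where "r = |A|"
  \<comment> \<open>What is asked of \<open>K\<close> at stage \<open>a\<close>, given the cliques
    chosen before. Off \<open>A\<close> nothing is asked, so that the recursion defines a total
    function.\<close>
  define P where "P f a K \<longleftrightarrow> (a \<in> A \<longrightarrow> K \<subseteq> Y - (\<Union>b\<in>underS r a. N (f b)) \<and>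
      complete_edges K \<subseteq> E \<and> |F a| \<le>o |K| \<and> |N K| <o |Y| )" for f a K
  have wo: "well_order_on A r" unfolding r_def by (rule card_of_well_order_on)
  have Fr: "Field r = A" by (simp add: r_def Field_card_of)
  have "\<exists>f. \<forall>a. P f a (f a)"
  proof (rule dependent_wf_choice)
    show "wf (r - Id)" using wo by (simp add: well_order_on_def)
    show "P f a K = P g a K" if "\<And>z. (z, a) \<in> r - Id \<Longrightarrow> f z = g z" for f g :: "'a \<Rightarrow> 'a set" and a K
      using that by (simp add: P_def underS_def)
    show "\<exists>K. P f a K" if ih: "\<And>b. (b, a) \<in> r - Id \<Longrightarrow> P f b (f b)" for f a
    proof (cases "a \<in> A")
      case False
      then show ?thesis by (simp add: P_def)
    next
      case True
      have sub: "underS r a \<subseteq> A"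
        using Fr by (auto simp: underS_def intro: FieldI1)
      have "|underS r a| <o |A|"
        using True card_of_underS[OF card_of_Card_order, of a A] by (simp add: Field_card_of r_def)
      moreover have "\<forall>b\<in>underS r a. |N (f b)| <o |Y|"
        using ih sub by (auto simp: P_def underS_def)
      \<comment> \<open>This is where the least size of \<open>A\<close> is used: fewer than
        \<open>|A|\<close> small exclusion sets cannot exhaust \<open>Y\<close>.\<close>
      ultimately have "|Sigma (underS r a) (\<lambda>b. N (f b))| <o |Y|"
        by (rule below)
      then have U: "|\<Union>b\<in>underS r a. N (f b)| <o |Y|" (is "|?U| <o _")
        using card_of_UNION_Sigma ordLeq_ordLess_trans by blast
      have "|Y| \<le>o |Y - ?U|"
      proof (rule ccontr)
        assume "\<not> ?thesis"
        then have "|(Y - ?U) \<union> ?U| <o |Y|"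
          using card_of_Un_ordLess_infinite[OF infY _ U] not_card_of_ordLeq by blast
        moreover have "|Y| \<le>o |(Y - ?U) \<union> ?U|"
          by (rule card_of_mono1) blast
        ultimately show False using not_card_of_ordLess by blast
      qed
      then show ?thesis
        using piece[of "Y - ?U" a] True by (auto simp: P_def)
    qed
  qed
  then obtain f where f: "\<And>a. P f a (f a)" by blast
  have fY: "f a \<subseteq> Y" if "a \<in> A" for a
    using f[of a] that by (auto simp: P_def)
  have adj: "x \<noteq> y \<and> {x, y} \<in> E" if "a \<in> A" "b \<in> A" "b \<in> underS r a" "x \<in> f b" "y \<in> f a" for a b x y
  proof -
    have "y \<in> Y" "y \<notin> non_neighbours E Y x"
      using f[of a] that by (auto simp: P_def N_def)
    then show ?thesis by (auto simp: non_neighbours_def)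
  qed
  have tot: "a = b \<or> a \<in> underS r b \<or> b \<in> underS r a" if "a \<in> A" "b \<in> A" for a b
    using wo that unfolding well_order_on_def linear_order_on_def total_on_def underS_def by auto
  \<comment> \<open>A common vertex of two stages would be distinct from itself by
    \<open>adj\<close>.\<close>
  have disj: "a = b" if "a \<in> A" "b \<in> A" "x \<in> f a" "x \<in> f b" for a b x
    using tot[of a b] adj[of a b x x] adj[of b a x x] that by blast
  define S where "S = (\<Union>a\<in>A. f a)"
  have SY: "S \<subseteq> Y" using fY by (auto simp: S_def)
  have "complete_edges S \<subseteq> E"
  proof -
    have "{x, y} \<in> E" if "x \<noteq> y" "a \<in> A" "b \<in> A" "x \<in> f a" "y \<in> f b" for a b x y
    proof -
      have "a = b \<Longrightarrow> {x, y} \<in> E"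
        using f[of a] that unfolding P_def complete_edges_def by blast
      then show ?thesis
        using tot[of a b] adj[of a b y x] adj[of b a x y] that by (metis insert_commute)
    qed
    then show ?thesis by (auto simp: complete_edges_def S_def)
  qed
  moreover have "|S| =o |Y|"
  proof -
    have "|Sigma A F| \<le>o |Sigma A f|"
      by (rule card_of_Sigma_mono1) (use f in \<open>auto simp: P_def\<close>)
    moreover have "inj_on snd (Sigma A f)"
    proof (rule inj_onI)
      fix p q assume "p \<in> Sigma A f" "q \<in> Sigma A f" "snd p = snd q"
      then show "p = q"
        using disj[of "fst p" "fst q" "snd p"] by (auto simp: prod_eq_iff)
    qed
    then have "|Sigma A f| \<le>o |S|"
      by (rule card_of_ordLeqI) (auto simp: S_def)
    ultimately have "|Y| \<le>o |S|"
      using AF(2) by (meson ordLeq_transitive)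
    then show ?thesis
      using card_of_mono1[OF SY] by (simp add: ordIso_iff_ordLeq)
  qed
  ultimately show ?case
    using subset_trans[OF SY Y(1)] ordIso_transitive[OF _ Y(2)] by blast
qed

lemma complete_edges_mono: "S \<subseteq> T \<Longrightarrow> complete_edges S \<subseteq> complete_edges T"
  unfolding complete_edges_def by blast

section \<open>Closed vertex sets\<close>

lemma contains_complete_mono: "W \<subseteq> V \<Longrightarrow> contains_complete W E \<mu> \<Longrightarrow> contains_complete V E \<mu>"
  unfolding contains_complete_def by blast

lemma contains_induced_K_omega_mono:
  assumes "W \<subseteq> V" "contains_induced_K_omega W E k"
  shows "contains_induced_K_omega V E k"
proof -
  obtain A B where "A \<subseteq> W" "B \<subseteq> W" and AB: "A \<inter> B = {} \<and> finite A \<and> card A = k \<and> |B| =o natLeq \<and>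
      induced_edges E (A \<union> B) = bipartite_edges A B"
    using assms(2) unfolding contains_induced_K_omega_def by (elim exE conjE) simp
  then have "A \<subseteq> V" "B \<subseteq> V" using assms(1) by auto
  then show ?thesis
    using AB unfolding contains_induced_K_omega_def by (intro exI[of _ A] exI[of _ B]) simp
qed

text \<open>Apply the Dushnik--Miller relation to a subset of \<open>W\<close> of size exactly
  \<mu>; a clique of that size is excluded.\<close>

lemma ex_independent_if_no_complete:
  fixes V :: "'a set" and \<mu> :: "'b rel"
  assumes \<mu>: "Card_order \<mu>" "infinite (Field \<mu>)"
    and "\<not> contains_complete V E \<mu>" "W \<subseteq> V" "\<not> |W| <o \<mu>"
  shows "\<exists>S\<subseteq>W. infinite S \<and> complete_edges S \<inter> E = {}"
proof (rule ccontr)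
  assume neg: "\<not> ?thesis"
  have "\<mu> \<le>o |W|"
    using assms(5) not_ordLess_iff_ordLeq[OF card_order_on_well_order_on[OF \<mu>(1)] card_of_Well_order[of W]] by simp
  \<comment> \<open>The field represents \<mu> as a set, which allows the passage from the type of
    \<mu> to the vertex type.\<close>
  then have "|Field \<mu>| \<le>o |W|"
    using card_of_Field_ordIso[OF \<mu>(1)] by (rule ordIso_ordLeq_trans[rotated])
  then obtain X where X: "X \<subseteq> W" "|Field \<mu>| =o |X|"
    using internalize_card_of_ordLeq2 by blast
  have "infinite X"
    using card_of_ordIso_finite[OF X(2)] \<mu>(2) by simp
  then obtain S where S: "S \<subseteq> X" "|S| =o |X|" "complete_edges S \<subseteq> E"
    using ex_clique_or_independent[of X E] neg X(1) by (meson subset_trans)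
  have "|S| =o \<mu>"
    using ordIso_transitive[OF S(2) ordIso_transitive[OF ordIso_symmetric[OF X(2)] card_of_Field_ordIso[OF \<mu>(1)]]] .
  moreover have "S \<subseteq> V" using S(1) X(1) assms(4) by simp
  ultimately show False
    using assms(3) S(3) unfolding contains_complete_def by blast
qed

section \<open>Common neighbours of independent sets and closure under them\<close>

definition common_neighbours :: "'a set \<Rightarrow> 'a set set \<Rightarrow> 'a set \<Rightarrow> 'a set" where
  "common_neighbours V E A = {v \<in> V. \<forall>a\<in>A. {a, v} \<in> E}"

definition independent_sets :: "'a set set \<Rightarrow> nat \<Rightarrow> 'a set \<Rightarrow> 'a set set" where
  "independent_sets E k U = {A. A \<subseteq> U \<and> finite A \<and> card A = k \<and> complete_edges A \<inter> E = {}}"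

definition neighbour_closed :: "'a set \<Rightarrow> 'a set set \<Rightarrow> nat \<Rightarrow> 'a set \<Rightarrow> bool" where
  "neighbour_closed V E k U \<longleftrightarrow> (\<forall>A\<in>independent_sets E k U. common_neighbours V E A \<subseteq> U)"

lemma induced_edges_eq_bipartite_edges:
  assumes "\<forall>e\<in>E. card e = 2" "complete_edges A \<inter> E = {}" "complete_edges B \<inter> E = {}"
    and "B \<subseteq> common_neighbours V E A"
  shows "induced_edges E (A \<union> B) = bipartite_edges A B"
proof
  show "induced_edges E (A \<union> B) \<subseteq> bipartite_edges A B"
  proof
    fix e assume e: "e \<in> induced_edges E (A \<union> B)"
    then have "card e = 2" using assms(1) by (simp add: induced_edges_def)
    then obtain x y where xy: "e = {x, y}" "x \<noteq> y" by (meson card_2_iff)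
    have "e \<notin> complete_edges A" "e \<notin> complete_edges B"
      using assms(2,3) e by (auto simp: induced_edges_def)
    then have "x \<in> A \<and> y \<in> B \<or> x \<in> B \<and> y \<in> A"
      using e xy unfolding induced_edges_def complete_edges_def by blast
    then show "e \<in> bipartite_edges A B"
      unfolding xy(1) bipartite_edges_def by (auto simp: insert_commute)
  qed
next
  show "bipartite_edges A B \<subseteq> induced_edges E (A \<union> B)"
    using assms(4) by (auto simp: induced_edges_def bipartite_edges_def common_neighbours_def)
qed

lemma card_of_common_neighbours:
  fixes V :: "'a set" and \<mu> :: "'b rel"
  assumes \<mu>: "Card_order \<mu>" "infinite (Field \<mu>)" and E: "\<forall>e\<in>E. card e = 2"
    and "\<not> contains_complete V E \<mu>" and no_induced: "\<not> contains_induced_K_omega V E k"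
    and A: "A \<in> independent_sets E k V"
  shows "|common_neighbours V E A| <o \<mu>"
proof (rule ccontr)
  assume neg: "\<not> ?thesis"
  have "common_neighbours V E A \<subseteq> V" by (auto simp: common_neighbours_def)
  from ex_independent_if_no_complete[OF \<mu> assms(4) this neg]
  obtain S where S: "S \<subseteq> common_neighbours V E A" "infinite S" "complete_edges S \<inter> E = {}"
    by blast
  \<comment> \<open>\<open>S\<close> may be uncountable, whereas the infinite class of the bipartite
    graph must be countable.\<close>
  then obtain B where B: "B \<subseteq> S" "|UNIV :: nat set| =o |B|"
    using internalize_card_of_ordLeq2 infinite_iff_card_of_nat by metis
  have "|B| =o natLeq"
    using ordIso_transitive[OF ordIso_symmetric[OF B(2)] card_of_nat] .
  \<comment> \<open>A vertex in both sets would be adjacent to itself, but edges have two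
    elements.\<close>
  moreover have "A \<inter> B = {}"
  proof -
    have "{x, x} \<notin> E" for x using E by force
    then show ?thesis using S(1) B(1) unfolding common_neighbours_def by blast
  qed
  moreover have "induced_edges E (A \<union> B) = bipartite_edges A B"
    using E A S B(1) complete_edges_mono[OF B(1)]
    by (intro induced_edges_eq_bipartite_edges[of _ _ _ V]) (auto simp: independent_sets_def)
  moreover have "B \<subseteq> V" using S(1) B(1) by (auto simp: common_neighbours_def)
  ultimately show False
    using no_induced A unfolding contains_induced_K_omega_def independent_sets_def by blast
qed

lemma card_of_neighbours_in_neighbour_closed:
  fixes V :: "'a set" and \<mu> :: "'b rel"
  assumes \<mu>: "Card_order \<mu>" "infinite (Field \<mu>)" and "\<not> contains_complete V E \<mu>"
    and U: "U \<subseteq> V" "neighbour_closed V E k U" and v: "v \<in> V - U"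
  shows "|neighbours E v \<inter> U| <o \<mu>"
proof (rule ccontr)
  assume neg: "\<not> ?thesis"
  have "neighbours E v \<inter> U \<subseteq> V" using U(1) by auto
  from ex_independent_if_no_complete[OF \<mu> assms(3) this neg]
  obtain S where S: "S \<subseteq> neighbours E v \<inter> U" "infinite S" "complete_edges S \<inter> E = {}"
    by blast
  obtain A where A: "A \<subseteq> S" "finite A" "card A = k"
    using infinite_arbitrarily_large[OF S(2)] by blast
  then have "A \<in> independent_sets E k U"
    using S complete_edges_mono[OF A(1)] unfolding independent_sets_def by blast
  then have "common_neighbours V E A \<subseteq> U"
    using U(2) by (simp add: neighbour_closed_def)
  moreover have "v \<in> common_neighbours V E A"
    using v A(1) S(1) by (auto simp: common_neighbours_def neighbours_def insert_commute)
  ultimately show False using v by blast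
qed

lemma card_of_finite_subsets_of_card:
  assumes "infinite D" "|Z| \<le>o |D|"
  shows "|{A. A \<subseteq> Z \<and> finite A \<and> card A = k}| \<le>o |D|"
proof (induction k)
  case 0
  have "{A. A \<subseteq> Z \<and> finite A \<and> card A = 0} = {{}}" by auto
  then show ?case
    using card_of_singl_ordLeq[of D "{}"] assms(1) by (metis finite.emptyI)
next
  case (Suc k)
  let ?P = "\<lambda>k. {A. A \<subseteq> Z \<and> finite A \<and> card A = k}"
  have "?P (Suc k) \<subseteq> (\<lambda>(x, A). insert x A) ` (Z \<times> ?P k)"
  proof
    fix A assume A: "A \<in> ?P (Suc k)"
    then have "card A = Suc k" by simp
    then obtain x B where x: "A = insert x B" "x \<notin> B" "card B = k" "finite B"
      by (metis card_Suc_eq_finite)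
    then have "x \<in> Z" "B \<in> ?P k" using A by auto
    then show "A \<in> (\<lambda>(x, A). insert x A) ` (Z \<times> ?P k)"
      using x(1) by auto
  qed
  then have "|?P (Suc k)| \<le>o |Z \<times> ?P k|"
    by (rule surj_imp_ordLeq)
  also have "|Z \<times> ?P k| \<le>o |D|"
    using card_of_Sigma_ordLeq_infinite[OF assms, of "\<lambda>_. ?P k"] Suc by simp
  finally show ?case .
qed

text \<open>Adding common neighbours \<omega> times suffices, since a finite set in the union
  already lies in one stage. Each stage has at most \<open>|D|\<close> subsets of size
  \<open>k\<close>, each contributing at most \<open>|D|\<close> vertices.\<close>

lemma ex_small_neighbour_closed:
  fixes Z V :: "'a set"
  assumes D: "infinite D" and Z: "Z \<subseteq> V" "|Z| \<le>o |D|"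
    and C: "\<And>A. A \<in> independent_sets E k V \<Longrightarrow> |common_neighbours V E A| \<le>o |D|"
  shows "\<exists>U. Z \<subseteq> U \<and> neighbour_closed V E k U \<and> |U| \<le>o |D|"
proof -
  define step where "step Y = Y \<union> (\<Union>A\<in>independent_sets E k Y. common_neighbours V E A)" for Y
  define S where "S n = (step ^^ n) Z" for n
  have S0: "S 0 = Z" and S_Suc: "S (Suc n) = step (S n)" for n
    by (simp_all add: S_def)
  have SV: "S n \<subseteq> V" for n
    by (induction n) (use Z in \<open>auto simp: S0 S_Suc step_def common_neighbours_def\<close>)
  have mono: "S m \<subseteq> S n" if "m \<le> n" for m n
    using that by (induction n rule: dec_induct) (auto simp: S_Suc step_def)
  have card: "|S n| \<le>o |D|" for n
  proof (induction n)
    case 0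
    then show ?case using Z(2) by (simp add: S0)
  next
    case (Suc n)
    have "|independent_sets E k (S n)| \<le>o |{A. A \<subseteq> S n \<and> finite A \<and> card A = k}|"
      by (rule card_of_mono1) (auto simp: independent_sets_def)
    also have "|{A. A \<subseteq> S n \<and> finite A \<and> card A = k}| \<le>o |D|"
      by (rule card_of_finite_subsets_of_card[OF D Suc])
    finally have "|\<Union>A\<in>independent_sets E k (S n). common_neighbours V E A| \<le>o |D|"
      using C SV[of n] by (intro card_of_UNION_ordLeq_infinite D) (auto simp: independent_sets_def)
    then have "|step (S n)| \<le>o |D|"
      unfolding step_def using D Suc
      by (intro card_of_Un_ordLeq_infinite_Field[OF _ _ _ card_of_Card_order]) (simp_all add: Field_card_of)
    then show ?case by (simp add: S_Suc)
  qed
  have "neighbour_closed V E k (\<Union>n. S n)"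
    unfolding neighbour_closed_def
  proof
    fix A assume A: "A \<in> independent_sets E k (\<Union>n. S n)"
    have "\<exists>n. A \<subseteq> S n"
    proof -
      have "finite A" "A \<subseteq> (\<Union>n. S n)" using A by (auto simp: independent_sets_def)
      moreover have "S m \<subseteq> S n \<or> S n \<subseteq> S m" for m n
        using mono linear[of m n] by blast
      then have "subset.chain UNIV (range S)"
        by (auto simp: subset_chain_def)
      ultimately show ?thesis
        using finite_subset_Union_chain[of A "range S" UNIV] by blast
    qed
    then obtain n where "A \<in> independent_sets E k (S n)"
      using A by (auto simp: independent_sets_def)
    then have "common_neighbours V E A \<subseteq> S (Suc n)"
      by (auto simp: S_Suc step_def)
    then show "common_neighbours V E A \<subseteq> (\<Union>n. S n)" by blast
  qed
  moreover have "|\<Union>n. S n| \<le>o |D|"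
    using D card by (intro card_of_UNION_ordLeq_infinite) (auto simp flip: infinite_iff_card_of_nat)
  moreover have "Z \<subseteq> (\<Union>n. S n)" using S0 by blast
  ultimately show ?thesis by blast
qed

text \<open>A finite nonempty subset of the union lies in one member. Positive \<open>k\<close>
  handles the empty chain: for \<open>k = 0\<close> the empty set is independent and has all of
  \<open>V\<close> as common neighbours.\<close>

lemma neighbour_closed_Union_chain:
  assumes "k > 0" "subset.chain UNIV \<U>" "\<And>U. U \<in> \<U> \<Longrightarrow> neighbour_closed V E k U"
  shows "neighbour_closed V E k (\<Union>\<U>)"
  unfolding neighbour_closed_def
proof
  fix A assume A: "A \<in> independent_sets E k (\<Union>\<U>)"
  then have "finite A" "A \<subseteq> \<Union>\<U>" "A \<noteq> {}"
    using assms(1) by (auto simp: independent_sets_def)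
  then obtain U where U: "U \<in> \<U>" "A \<subseteq> U"
    using finite_subset_Union_chain[of A \<U> UNIV] assms(2) by blast
  then have "A \<in> independent_sets E k U"
    using A by (simp add: independent_sets_def)
  then show "common_neighbours V E A \<subseteq> \<Union>\<U>"
    using assms(3)[OF U(1)] U(1) unfolding neighbour_closed_def by blast
qed

text \<open>This makes the hull of a vertex set closed.\<close>

lemma neighbour_closed_Inter:
  "(\<And>U. U \<in> \<U> \<Longrightarrow> neighbour_closed V E k U) \<Longrightarrow> neighbour_closed V E k (\<Inter>\<U>)"
  unfolding neighbour_closed_def independent_sets_def by blast

lemma neighbour_closed_self: "neighbour_closed V E k V"
  unfolding neighbour_closed_def common_neighbours_def by blast

section \<open>Concatenating orders\<close>

text \<open>Order lexicographically, first by rank and then within the fibre. The earlier neighbours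
  of \<open>v\<close> have smaller rank or precede \<open>v\<close> in its own fibre; both kinds
  number fewer than the infinite \<mu>.\<close>

lemma has_colouring_order_glue:
  fixes V :: "'a set" and I :: "'i set" and \<mu> :: "'b rel" and rank :: "'a \<Rightarrow> 'i"
  assumes \<mu>: "Card_order \<mu>" "infinite (Field \<mu>)"
    and r: "well_order_on I r" and rank: "\<And>v. v \<in> V \<Longrightarrow> rank v \<in> I"
    and fibre: "\<And>i. i \<in> I \<Longrightarrow> has_colouring_order {v \<in> V. rank v = i} E \<mu>"
    and earlier: "\<And>v. v \<in> V \<Longrightarrow> |neighbours E v \<inter> {w \<in> V. rank w \<in> underS r (rank v)}| <o \<mu>"
  shows "has_colouring_order V E \<mu>"
proof -
  define F where "F i = {v \<in> V. rank v = i}" for i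
  have "\<forall>i\<in>I. \<exists>s. well_order_on (F i) s \<and> (\<forall>v\<in>F i. |neighbours E v \<inter> underS s v| <o \<mu>)"
    using fibre unfolding has_colouring_order_def F_def by blast
  from bchoice[OF this] obtain s where s: "\<And>i. i \<in> I \<Longrightarrow> well_order_on (F i) (s i)"
      "\<And>i v. i \<in> I \<Longrightarrow> v \<in> F i \<Longrightarrow> |neighbours E v \<inter> underS (s i) v| <o \<mu>"
    by blast
  define t where "t = {(x, y). x \<in> V \<and> y \<in> V \<and>
      (rank x \<in> underS r (rank y) \<or> rank x = rank y \<and> (x, y) \<in> s (rank y))}"
  have r_lin: "refl_on I r" "trans r" "antisym r" "total_on I r" "wf (r - Id)" "r \<subseteq> I \<times> I"
    using r by (auto simp: well_order_on_def linear_order_on_def partial_order_on_def preorder_on_def)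
  have s_lin: "refl_on (F i) (s i)" "trans (s i)" "antisym (s i)" "total_on (F i) (s i)"
    "wf (s i - Id)" "s i \<subseteq> F i \<times> F i" if "i \<in> I" for i
    using s(1)[OF that]
    by (auto simp: well_order_on_def linear_order_on_def partial_order_on_def preorder_on_def)
  have S_trans: "a \<in> underS r c" if "a \<in> underS r b" "b \<in> underS r c" for a b c
    using that r_lin(2,3) unfolding underS_def trans_def antisym_def by blast
  have S_irrefl: "a \<notin> underS r a" for a by (simp add: underS_def)
  have "refl_on V t"
    using s_lin(1) rank by (auto simp: refl_on_def t_def F_def)
  moreover have "t \<subseteq> V \<times> V" by (auto simp: t_def)
  moreover have "trans t"
  proof (rule transI)
    fix x y z assume xy: "(x, y) \<in> t" and yz: "(y, z) \<in> t"
    have "(x, z) \<in> s (rank z)" if "rank x = rank y" "rank y = rank z"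
      "(x, y) \<in> s (rank y)" "(y, z) \<in> s (rank z)"
      using that s_lin(2)[OF rank, of z] yz by (auto simp: t_def dest: transD)
    then show "(x, z) \<in> t"
      using xy yz S_trans unfolding t_def by auto
  qed
  moreover have "antisym t"
  proof (rule antisymI)
    fix x y assume xy: "(x, y) \<in> t" and yx: "(y, x) \<in> t"
    then have "rank x = rank y"
      using S_trans[of "rank x" "rank y" "rank x"] S_irrefl[of "rank x"] by (auto simp: t_def)
    then show "x = y"
      using xy yx S_irrefl s_lin(3)[OF rank, of x] by (auto simp: t_def dest: antisymD)
  qed
  moreover have "total_on V t"
  proof (rule total_onI)
    fix x y assume xy: "x \<in> V" "y \<in> V" "x \<noteq> y"
    show "(x, y) \<in> t \<or> (y, x) \<in> t"
    proof (cases "rank x = rank y")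
      case True
      then show ?thesis
        using xy s_lin(4)[OF rank, of x] unfolding total_on_def t_def F_def by auto
    next
      case False
      then show ?thesis
        using xy rank[of x] rank[of y] r_lin(4) unfolding total_on_def t_def underS_def by auto
    qed
  qed
  moreover have "wf (t - Id)"
  proof (rule wfI_min)
    fix x Q assume "x \<in> (Q :: 'a set)"
    show "\<exists>z\<in>Q. \<forall>y. (y, z) \<in> t - Id \<longrightarrow> y \<notin> Q"
    proof (cases "Q \<inter> V = {}")
      case True
      \<comment> \<open>Well-foundedness concerns the whole type; points outside \<open>V\<close>
        have no predecessors in \<open>t\<close>.\<close>
      then show ?thesis using \<open>x \<in> Q\<close> by (auto simp: t_def)
    next
      case False
      then have "rank ` (Q \<inter> V) \<noteq> {}" by blast
      then obtain i where i: "i \<in> rank ` (Q \<inter> V)" "\<And>j. (j, i) \<in> r - Id \<Longrightarrow> j \<notin> rank ` (Q \<inter> V)"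
        using wfE_min'[OF r_lin(5), of "rank ` (Q \<inter> V)"] by metis
      then have iI: "i \<in> I" and "Q \<inter> F i \<noteq> {}" using rank by (auto simp: F_def)
      then obtain z where z: "z \<in> Q \<inter> F i" "\<And>y. (y, z) \<in> s i - Id \<Longrightarrow> y \<notin> Q \<inter> F i"
        using wfE_min'[OF s_lin(5)[OF iI], of "Q \<inter> F i"] by metis
      have "y \<notin> Q" if y: "(y, z) \<in> t - Id" for y
      proof
        assume "y \<in> Q"
        moreover have "y \<in> V" "rank z = i" using y z(1) by (auto simp: t_def F_def)
        ultimately have "rank y \<notin> underS r (rank z)"
          using i(2)[of "rank y"] by (auto simp: underS_def)
        then have "(y, z) \<in> s i - Id" "y \<in> F i"
          using y \<open>rank z = i\<close> \<open>y \<in> V\<close> by (auto simp: t_def F_def)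
        then show False using z(2) \<open>y \<in> Q\<close> by blast
      qed
      then show ?thesis using z(1) by blast
    qed
  qed
  ultimately have "well_order_on V t"
    by (simp add: well_order_on_def linear_order_on_def partial_order_on_def preorder_on_def)
  moreover have "|neighbours E v \<inter> underS t v| <o \<mu>" if v: "v \<in> V" for v
  proof -
    let ?N = "neighbours E v"
    have "?N \<inter> underS t v \<subseteq>
        (?N \<inter> {w \<in> V. rank w \<in> underS r (rank v)}) \<union> (?N \<inter> underS (s (rank v)) v)"
      by (auto simp: t_def underS_def)
    moreover have "|\<dots>| <o \<mu>"
      using earlier[OF v] s(2)[OF rank[OF v], of v] v
      by (intro card_of_Un_ordLess_infinite_Field \<mu>) (simp_all add: F_def)
    ultimately show ?thesis
      using card_of_mono1 ordLeq_ordLess_trans by blast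
  qed
  ultimately show ?thesis
    unfolding has_colouring_order_def by blast
qed

section \<open>The induction on the size of the vertex set\<close>

lemma has_colouring_order_if_no_subgraphs:
  fixes V :: "'a set" and \<mu> :: "'b rel"
  assumes \<mu>: "Card_order \<mu>" "infinite (Field \<mu>)" and E: "\<forall>e\<in>E. card e = 2" and k: "k > 0"
    and "\<not> contains_complete V E \<mu>" "\<not> contains_induced_K_omega V E k"
  shows "has_colouring_order V E \<mu>"
  using assms(5,6)
proof (induction V rule: wf_induct_rule[OF wf_inv_image[OF wf_ordLess, of card_of]])
  case (1 V)
  note no_K = "1.prems"
  show ?case
  proof (cases "|V| \<le>o \<mu>")
    case True
    then show ?thesis
      using has_colouring_order_card_of[of V E] ordLess_ordLeq_trans
      unfolding has_colouring_order_def by blast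
  next
    case False
    then have \<mu>V: "\<mu> <o |V|"
      using not_ordLeq_iff_ordLess[OF card_order_on_well_order_on[OF \<mu>(1)] card_of_Well_order[of V]] by simp
    have Fld: "|Field \<mu>| <o |V|"
      using card_of_Field_ordIso[OF \<mu>(1)] \<mu>V by (rule ordIso_ordLess_trans)
    have infV: "infinite V"
      using card_of_ordLeq_infinite[OF ordLess_imp_ordLeq[OF Fld] \<mu>(2)] .
    define r where "r = |V|"
    have wo: "well_order_on V r" unfolding r_def by (rule card_of_well_order_on)
    then have r: "refl_on V r" "trans r" "total_on V r" "wf (r - Id)" "r \<subseteq> V \<times> V"
      by (auto simp: well_order_on_def linear_order_on_def partial_order_on_def preorder_on_def)
    \<comment> \<open>Taking the least closed set makes the closures increase with \<open>a\<close>,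
      which closures chosen separately need not do.\<close>
    define cl where "cl a = neighbour_closed V E k hull (under r a)" for a
    have closed: "neighbour_closed V E k (cl a)" for a
      unfolding cl_def by (rule hull_in) (rule neighbour_closed_Inter, blast)
    have cl_V: "cl a \<subseteq> V" for a
      unfolding cl_def by (rule hull_minimal) (use r(5) in \<open>auto simp: under_def neighbour_closed_self\<close>)
    have cl_mono: "cl a \<subseteq> cl b" if "(a, b) \<in> r" for a b
      unfolding cl_def by (rule hull_mono) (use that r(2) in \<open>auto simp: under_def dest: transD\<close>)
    have cl_card: "|cl a| <o |V|" if a: "a \<in> V" for a
    proof -
      \<comment> \<open>Large enough to bound the initial segment and, through \<mu>, all sets of
        common neighbours, but still smaller than \<open>V\<close>.\<close>
      define D where "D = under r a <+> Field \<mu>"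
      have "under r a \<subseteq> {a} \<union> underS r a" by (auto simp: under_def underS_def)
      moreover have "|{a} \<union> underS r a| <o |V|"
        using a card_of_underS[OF card_of_Card_order, of a V] finite_card_of_ordLess[OF _ infV, of "{a}"]
        by (intro card_of_Un_ordLess_infinite infV) (simp_all add: r_def Field_card_of)
      ultimately have "|under r a| <o |V|"
        using card_of_mono1 ordLeq_ordLess_trans by blast
      then have DV: "|D| <o |V|"
        unfolding D_def using Fld by (rule card_of_Plus_ordLess_infinite[OF infV])
      have infD: "infinite D" using \<mu>(2) by (simp add: D_def)
      have "\<mu> \<le>o |D|"
        unfolding D_def by (rule Card_order_Plus2[OF \<mu>(1)])
      then have C: "|common_neighbours V E A| \<le>o |D|" if "A \<in> independent_sets E k V" for A
        using card_of_common_neighbours[OF \<mu> E no_K that]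
        by (meson ordLess_ordLeq_trans ordLess_imp_ordLeq)
      have under_V: "under r a \<subseteq> V" using r(5) by (auto simp: under_def)
      have under_D: "|under r a| \<le>o |D|" unfolding D_def by (rule card_of_Plus1)
      obtain U where U: "under r a \<subseteq> U" "neighbour_closed V E k U" "|U| \<le>o |D|"
        using ex_small_neighbour_closed[OF infD under_V under_D, of E k] C by blast
      have "cl a \<subseteq> U" unfolding cl_def by (rule hull_minimal) (fact U)+
      then show ?thesis
        using ordLeq_ordLess_trans[OF ordLeq_transitive[OF card_of_mono1 U(3)] DV] by blast
    qed
    \<comment> \<open>The rank of \<open>v\<close> is the first stage whose closure contains it, so
      the fibres of the rank are the successive differences of the closures.\<close>
    have "\<exists>a\<in>V. v \<in> cl a \<and> (\<forall>b\<in>underS r a. v \<notin> cl b)" if v: "v \<in> V" for v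
    proof -
      have "v \<in> cl v"
        unfolding cl_def using r(1) v hull_subset[of "under r v"] by (auto simp: under_def refl_on_def)
      then have "{a \<in> V. v \<in> cl a} \<noteq> {}" using v by blast
      then obtain a where "a \<in> {a \<in> V. v \<in> cl a}" "\<And>b. (b, a) \<in> r - Id \<Longrightarrow> b \<notin> {a \<in> V. v \<in> cl a}"
        using wfE_min'[OF r(4), of "{a \<in> V. v \<in> cl a}"] by metis
      then show ?thesis using r(5) by (auto simp: underS_def)
    qed
    then obtain rank where rank: "\<And>v. v \<in> V \<Longrightarrow> rank v \<in> V" "\<And>v. v \<in> V \<Longrightarrow> v \<in> cl (rank v)"
        "\<And>v b. v \<in> V \<Longrightarrow> b \<in> underS r (rank v) \<Longrightarrow> v \<notin> cl b"
      by metis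
    show ?thesis
    proof (rule has_colouring_order_glue[OF \<mu> wo, of V rank])
      show "rank v \<in> V" if "v \<in> V" for v using rank(1) that .
      show "has_colouring_order {v \<in> V. rank v = a} E \<mu>" if a: "a \<in> V" for a
      proof -
        \<comment> \<open>The induction shrinks only the vertex set and keeps \<open>E\<close>, so
          edges may leave the vertex set; this is why \<open>E\<close> is required to have
          two-element edges rather than to form a simple graph on \<open>V\<close>.\<close>
        let ?W = "{v \<in> V. rank v = a}"
        have "?W \<subseteq> cl a" using rank(2) by auto
        then have "|?W| <o |V|"
          using ordLeq_ordLess_trans[OF card_of_mono1 cl_card[OF a]] by blast
        then have "(?W, V) \<in> inv_image ordLess card_of"
          by (simp add: inv_image_def)
        moreover have "\<not> contains_complete ?W E \<mu>" "\<not> contains_induced_K_omega ?W E k"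
          using no_K contains_complete_mono[of ?W V E \<mu>] contains_induced_K_omega_mono[of ?W V E k] by auto
        ultimately show ?thesis
          by (rule "1.IH")
      qed
      show "|neighbours E v \<inter> {w \<in> V. rank w \<in> underS r (rank v)}| <o \<mu>" if v: "v \<in> V" for v
      proof -
        \<comment> \<open>The union of all earlier closures is closed as the union of a chain and
          misses \<open>v\<close> by the choice of its rank, so \<open>v\<close> has few neighbours
          in it.\<close>
        define U where "U = \<Union>(cl ` underS r (rank v))"
        have "a \<in> V" if "a \<in> underS r (rank v)" for a
          using that r(5) by (auto simp: underS_def)
        then have "subset.chain UNIV (cl ` underS r (rank v))"
          using cl_mono r(3) unfolding subset_chain_def total_on_def
          by (smt (verit) UNIV_I image_iff order_refl subsetI)
        then have "neighbour_closed V E k U"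
          unfolding U_def using closed by (intro neighbour_closed_Union_chain[OF k]) auto
        moreover have "U \<subseteq> V" using cl_V by (auto simp: U_def)
        moreover have "v \<in> V - U" using v rank(3) by (auto simp: U_def)
        ultimately have "|neighbours E v \<inter> U| <o \<mu>"
          by (intro card_of_neighbours_in_neighbour_closed[OF \<mu> no_K(1)])
        moreover have "neighbours E v \<inter> {w \<in> V. rank w \<in> underS r (rank v)} \<subseteq> neighbours E v \<inter> U"
          using rank(2) by (auto simp: U_def)
        ultimately show ?thesis
          using card_of_mono1 ordLeq_ordLess_trans by blast
      qed
    qed
  qed
qed

theorem theorem1p4:
  fixes V :: "'a set" and E :: "'a set set" and \<mu> :: "'b rel"
  assumes "simple_graph V E"
    and "Card_order \<mu>" and "infinite (Field \<mu>)"
    and "\<mu> <o colouring_number V E"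
  shows "contains_complete V E \<mu> \<or> (\<forall>k::nat. k > 0 \<longrightarrow> contains_induced_K_omega V E k)"
proof (rule ccontr)
  assume "\<not> ?thesis"
  then obtain k :: nat where "k > 0" "\<not> contains_complete V E \<mu>" "\<not> contains_induced_K_omega V E k"
    by blast
  moreover have "\<forall>e\<in>E. card e = 2" using assms(1) by (simp add: simple_graph_def)
  ultimately have "has_colouring_order V E \<mu>"
    using has_colouring_order_if_no_subgraphs assms(2,3) by blast
  then have "colouring_number V E \<le>o \<mu>"
    by (rule colouring_number_least[OF assms(2)])
  then show False
    using assms(4) not_ordLess_ordLeq by blast
qed

end
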